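(* Let $(S,N)$ be a quadratic normalisation of class $(3,4)$ or of class $(4,3)$, and let $R=\{\,s|t\to\overline{N}(s|t)\;:\;s,t\in S,\ s|t\neq\overline{N}(s|t)\,\}$ be the associated rewriting system. Then $(S,R)$ is convergent, and every rewriting sequence $w_0\to_R w_1\to_R\cdots\to_R w_\ell$ starting from a word $w_0$ of length $p$ satisfies $\ell\le 2^p-p-1$.
   Context: For a set $S$, $S^*$ is the free monoid of words over $S$, $\|w\|$ is the length of $w$, $u|v$ denotes concatenation, and $S^{[p]}$ is the set of words of length $p$. A normalisation is a pair $(S,N)$ with $N:S^*\to S^*$ such that for all words $u,v,w$: $\|N(w)\|=\|w\|$; $\|w\|=1$ implies $N(w)=w$; and $N(u|N(w)|v)=N(u|w|v)$. A word $w$ is $N$-normal if $N(w)=w$. $\overline{N}$ denotes the restriction of $N$ to $S^{[2]}$. $\overline{N}_i$ applies $\overline{N}$ to the entries of a word in positions $i,i+1$; for a sequence of positions $u=i_1\cdots i_n$, $\overline{N}_u=\overline{N}_{i_n}\circ\cdots\circ\overline{N}_{i_1}$ ($\overline{N}_{i_1}$ applied first). $(S,N)$ is quadratic if (a) a word is $N$-normal if and only if each of its length-two factors is $N$-normal, and (b) for every word $w$ there is a finite sequence $u$ of positions with $N(w)=\overline{N}_u(w)$. A quadratic normalisation is of class $(4,3)$ if $N(w)=\overline{N}_{1212}(w)=\overline{N}_{212}(w)$ for all $w\in S^{[3]}$, and of class $(3,4)$ if $N(w)=\overline{N}_{121}(w)=\overline{N}_{2121}(w)$ for all $w\in S^{[3]}$.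 A rewriting system $(S,R)$ is a set $S$ with a set $R$ of pairs (rules) $w\to w'$ of words over $S$; $\to_R$ is the relation $u|w|v\to_R u|w'|v$ for $u,v\in S^*$ and $w\to w'$ in $R$, and $\to_R^*$ is its reflexive-transitive closure. $(S,R)$ is confluent if $w\to_R^*w_1$ and $w\to_R^*w_2$ imply that there is $w'$ with $w_1\to_R^*w'$ and $w_2\to_R^*w'$; it terminates if there is no infinite sequence $w_0\to_R w_1\to_R\cdots$; it is convergent if it is confluent and terminates. *)

theory Defs
  imports Main "HOL-Library.FuncSet" "HOL-Library.Sublist" "HOL-Library.Confluence"
begin

text \<open>
  Words over a set \<open>S\<close> are the elements of \<^term>\<open>lists S\<close>; the values of a
  normalisation map on lists outside \<^term>\<open>lists S\<close> are irrelevant.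
\<close>

locale normalisation =
  fixes S :: "'a set" and N :: "'a list \<Rightarrow> 'a list"
  assumes maps_words: "N \<in> lists S \<rightarrow> lists S"
    and length_preserving: "w \<in> lists S \<Longrightarrow> length (N w) = length w"
    and letter: "w \<in> lists S \<Longrightarrow> length w = 1 \<Longrightarrow> N w = w"
    and absorb: "u \<in> lists S \<Longrightarrow> v \<in> lists S \<Longrightarrow> w \<in> lists S \<Longrightarrow> N (u @ N w @ v) = N (u @ w @ v)"

definition normal_word :: "('a list \<Rightarrow> 'a list) \<Rightarrow> 'a list \<Rightarrow> bool" where
  "normal_word N w \<longleftrightarrow> N w = w"

text \<open>
  Positions are counted from 1. The map at position \<open>i\<close> acts on the \<open>i\<close>th and \<open>(i + 1)\<close>st
  entries; where these entries do not both exist it is set to be the identity.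
\<close>

definition norm_at :: "('a list \<Rightarrow> 'a list) \<Rightarrow> nat \<Rightarrow> 'a list \<Rightarrow> 'a list" where
  "norm_at N i w =
    (if 1 \<le> i \<and> i < length w
     then take (i - 1) w @ N [w ! (i - 1), w ! i] @ drop (i + 1) w
     else w)"

text \<open>The first position of the sequence is applied first.\<close>

definition norm_seq :: "('a list \<Rightarrow> 'a list) \<Rightarrow> nat list \<Rightarrow> 'a list \<Rightarrow> 'a list" where
  "norm_seq N u = fold (norm_at N) u"

locale quadratic_normalisation = normalisation +
  assumes normal_iff_factors: "w \<in> lists S \<Longrightarrow>
      normal_word N w \<longleftrightarrow> (\<forall>x. sublist x w \<and> length x = 2 \<longrightarrow> normal_word N x)"
    and ex_positions: "w \<in> lists S \<Longrightarrow>
      \<exists>u. set u \<subseteq> {1..<length w} \<and> N w = norm_seq N u w"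

locale quadratic_normalisation_4_3 = quadratic_normalisation +
  assumes class_4_3: "w \<in> lists S \<Longrightarrow> length w = 3 \<Longrightarrow>
      N w = norm_seq N [1,2,1,2] w \<and> N w = norm_seq N [2,1,2] w"

locale quadratic_normalisation_3_4 = quadratic_normalisation +
  assumes class_3_4: "w \<in> lists S \<Longrightarrow> length w = 3 \<Longrightarrow>
      N w = norm_seq N [1,2,1] w \<and> N w = norm_seq N [2,1,2,1] w"

inductive rewrite_step :: "'a set \<Rightarrow> ('a list \<times> 'a list) set \<Rightarrow> 'a list \<Rightarrow> 'a list \<Rightarrow> bool"
  for S R where
  "u \<in> lists S \<Longrightarrow> v \<in> lists S \<Longrightarrow> (w, w') \<in> R \<Longrightarrow> rewrite_step S R (u @ w @ v) (u @ w' @ v)"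

definition terminating :: "'a set \<Rightarrow> ('a list \<times> 'a list) set \<Rightarrow> bool" where
  "terminating S R \<longleftrightarrow> \<not> (\<exists>f :: nat \<Rightarrow> 'a list. \<forall>i. rewrite_step S R (f i) (f (Suc i)))"

text \<open>
  When the rules relate words over \<open>S\<close>, lists outside \<^term>\<open>lists S\<close> take part in no
  rewriting step, so confluence on the whole type is confluence on words over \<open>S\<close>.
\<close>

definition convergent_rewriting :: "'a set \<Rightarrow> ('a list \<times> 'a list) set \<Rightarrow> bool" where
  "convergent_rewriting S R \<longleftrightarrow> confluentp (rewrite_step S R) \<and> terminating S R"

definition normalisation_rules ::
  "'a set \<Rightarrow> ('a list \<Rightarrow> 'a list) \<Rightarrow> ('a list \<times> 'a list) set" where
  "normalisation_rules S N = {([s, t], N [s, t]) | s t. s \<in> S \<and> t \<in> S \<and> [s, t] \<noteq> N [s, t]}"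

end

theory Submission
  imports Defs
begin

text \<open>
  Up to reversal of words, the class is $(4,3)$. Then the letters satisfy a domino rule, which says
  how \<open>N\<close> treats a letter followed by a normal word, and from which one can follow how a rewriting
  step affects the first letters of the normal forms of all factors of a word \<open>w\<close> of length \<open>p\<close>
  (entries being counted from 0). Let \<open>m k > k\<close> be such that \<open>w ! k\<close> followed by the first letter
  of the normal form of \<open>w ! (k + 1), \<dots>, w ! (j - 1)\<close> is normal whenever \<open>k + 1 < j \<le> m k\<close>;
  initially one takes \<open>m k = k + 1\<close>. A step at entries \<open>i\<close>, \<open>i + 1\<close>
  requires \<open>m i = i + 1\<close>, and after it one may take \<open>m i\<close> to be the old value of \<open>m (i + 1)\<close>, at
  the cost of resetting \<open>m (i + 1)\<close> to \<open>i + 2\<close> and lowering from \<open>i + 1\<close> to \<open>i\<close> those \<open>m k\<close> with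
  \<open>k < i\<close> that equal \<open>i + 1\<close>. With \<open>e v\<close> the number of \<open>k\<close> such that \<open>m k \<le> v\<close>, such a step
  replaces both \<open>e i\<close> and \<open>e (i + 1)\<close> by \<open>e (i + 1) - 1\<close> and leaves the other values of \<open>e\<close>
  unchanged, hence decreases the sum of all \<open>2 ^ e v\<close> with \<open>v < p\<close>. This sum is \<open>2 ^ p - 1\<close> at the
  beginning and never less than \<open>p\<close>.
\<close>

section \<open>The combinatorial potential\<close>

definition bound_update :: "nat \<Rightarrow> (nat \<Rightarrow> nat) \<Rightarrow> nat \<Rightarrow> nat" where
  "bound_update i m k =
    (if k < i then (if m k = i + 1 then i else m k)
     else if k = i then m (i + 1)
     else if k = i + 1 then i + 2
     else m k)"

definition potential :: "nat \<Rightarrow> (nat \<Rightarrow> nat) \<Rightarrow> nat" where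
  "potential p m = (\<Sum>v<p. 2 ^ card {k. k < p \<and> m k \<le> v})"

lemma potential_ge: "p \<le> potential p m"
proof -
  have "(\<Sum>v<p. 1) \<le> potential p m"
    unfolding potential_def by (rule sum_mono) simp
  then show ?thesis by simp
qed

lemma potential_Suc: "potential p Suc = 2 ^ p - 1"
proof -
  have "{k. k < p \<and> Suc k \<le> v} = {..<v}" if "v < p" for v
    using that by auto
  then have "potential p Suc = (\<Sum>v<p. 2 ^ v)"
    unfolding potential_def by simp
  also have "\<dots> = 2 ^ p - 1"
    using sum_power2[of p] by (simp add: atLeast0LessThan)
  finally show ?thesis .
qed

text \<open>With \<open>c\<close> one less than the size of \<open>E (i + 1)\<close>, the terms at
  \<open>i\<close> and \<open>i + 1\<close> both become \<open>2 ^ c\<close>, and together they make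
  up the old term at \<open>i + 1\<close>. What is lost is the old term at \<open>i\<close>, a
  positive number.\<close>

lemma potential_bound_update:
  assumes i: "i + 1 < p" and mi: "m i = i + 1" and gt: "\<And>k. k < p \<Longrightarrow> k < m k"
  shows "potential p (bound_update i m) < potential p m"
proof -
  define E where "E v = {k. k < p \<and> m k \<le> v}" for v
  define E' where "E' v = {k. k < p \<and> bound_update i m k \<le> v}" for v
  have fin: "finite (E v)" for v
    unfolding E_def by simp
  have gti: "m (i + 1) \<ge> i + 2"
    using gt[of "i + 1"] i by simp
  have iE: "i \<in> E (i + 1)"
    unfolding E_def using i mi by simp
  \<comment> \<open>After the update no \<open>k < p\<close> has the value \<open>i + 1\<close>, so
    the levels \<open>i\<close> and \<open>i + 1\<close> give the same set; only \<open>i\<close>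
    drops out, its new value being at least \<open>i + 2\<close>.\<close>
  have new: "E' v = E (i + 1) - {i}" if "v = i \<or> v = i + 1" for v
  proof (rule set_eqI)
    fix k
    consider "k < i" | "k = i" | "k = i + 1" | "k > i + 1" by linarith
    then show "k \<in> E' v \<longleftrightarrow> k \<in> E (i + 1) - {i}"
      using that gti gt[of k] i mi unfolding E_def E'_def bound_update_def
      by cases auto
  qed
  have same: "card (E' v) = card (E v)" if v: "v \<noteq> i" "v \<noteq> i + 1" for v
  proof (cases "v < i")
    case True
    have "E' v = E v"
    proof (rule set_eqI)
      fix k
      consider "k < i" | "k = i" | "k = i + 1" | "k > i + 1" by linarith
      then show "k \<in> E' v \<longleftrightarrow> k \<in> E v"
        using True gti gt[of k] i mi unfolding E_def E'_def bound_update_def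
        by cases auto
    qed
    then show ?thesis by simp
  next
    case False
    then have vge: "v \<ge> i + 2" using v by linarith
    have iv: "i \<in> E v" unfolding E_def using i mi vge by simp
    show ?thesis
    proof (cases "i + 1 \<in> E v")
      case True
      have "E' v = E v"
      proof (rule set_eqI)
        fix k
        consider "k < i" | "k = i" | "k = i + 1" | "k > i + 1" by linarith
        then show "k \<in> E' v \<longleftrightarrow> k \<in> E v"
          using True vge i mi unfolding E_def E'_def bound_update_def by cases auto
      qed
      then show ?thesis by simp
    next
      case False
      \<comment> \<open>Here \<open>m (i + 1) > v\<close>, so \<open>i\<close> inherits a value
        above \<open>v\<close> while \<open>i + 1\<close> is reset to one that is at most
        \<open>v\<close>: one element is exchanged for another.\<close>
      have "E' v = insert (i + 1) (E v - {i})"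
      proof (rule set_eqI)
        fix k
        consider "k < i" | "k = i" | "k = i + 1" | "k > i + 1" by linarith
        then show "k \<in> E' v \<longleftrightarrow> k \<in> insert (i + 1) (E v - {i})"
          using False vge i mi unfolding E_def E'_def bound_update_def by cases auto
      qed
      then show ?thesis
        using False fin[of v] card_Suc_Diff1[OF fin[of v] iv] by simp
    qed
  qed
  define c where "c = card (E (i + 1) - {i})"
  have split: "(\<Sum>v<p. g v) = g i + g (i + 1) + (\<Sum>v\<in>{..<p} - {i, i + 1}. g v)" for g :: "nat \<Rightarrow> nat"
    using i sum.subset_diff[of "{i, i + 1}" "{..<p}" g] by simp
  have "(\<Sum>v<p. (2::nat) ^ card (E' v)) = 2 ^ c + 2 ^ c + (\<Sum>v\<in>{..<p} - {i, i + 1}. 2 ^ card (E v))"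
    unfolding split by (simp add: new same c_def)
  moreover have "(\<Sum>v<p. (2::nat) ^ card (E v)) =
      2 ^ card (E i) + 2 ^ Suc c + (\<Sum>v\<in>{..<p} - {i, i + 1}. 2 ^ card (E v))"
    unfolding split c_def using card_Suc_Diff1[OF fin iE] by simp
  ultimately show ?thesis
    unfolding potential_def E_def[symmetric] E'_def[symmetric] by simp
qed

section \<open>The domino rule\<close>

context normalisation
begin

lemma closed: "w \<in> lists S \<Longrightarrow> N w \<in> lists S"
  using maps_words by auto

lemma idem: "w \<in> lists S \<Longrightarrow> N (N w) = N w"
  using absorb[of "[]" "[]" w] by simp

lemma N_pair:
  assumes "s \<in> S" "t \<in> S"
  obtains a b where "N [s, t] = [a, b]" "a \<in> S" "b \<in> S"
proof -
  have "length (N [s, t]) = 2" and "N [s, t] \<in> lists S"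
    using assms length_preserving[of "[s, t]"] closed[of "[s, t]"] by auto
  then show ?thesis
    using that by (auto simp: length_Suc_conv numeral_2_eq_2)
qed

lemma rewrite_step_cases:
  assumes "rewrite_step S (normalisation_rules S N) w w'"
  obtains u s t v where "u \<in> lists S" "v \<in> lists S" "s \<in> S" "t \<in> S" "N [s, t] \<noteq> [s, t]"
    "w = u @ [s, t] @ v" "w' = u @ N [s, t] @ v"
  using assms unfolding normalisation_rules_def rewrite_step.simps by force

lemma rewrite_step_invariants:
  assumes "rewrite_step S (normalisation_rules S N) w w'"
  shows "w \<in> lists S" "w' \<in> lists S" "length w' = length w" "N w' = N w"
proof -
  obtain u s t v where *: "u \<in> lists S" "v \<in> lists S" "s \<in> S" "t \<in> S"
    "w = u @ [s, t] @ v" "w' = u @ N [s, t] @ v"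
    using assms by (rule rewrite_step_cases)
  then show "w \<in> lists S" "w' \<in> lists S" "length w' = length w"
    using closed[of "[s, t]"] length_preserving[of "[s, t]"] by auto
  show "N w' = N w"
    using * absorb[of u v "[s, t]"] by simp
qed

end

text \<open>Common to class (4,3) and the mirror image of class (3,4): once \<open>x\<close> has met
  \<open>s\<close>, the letter \<open>x'\<close> left behind is compatible with what
  \<open>s'\<close> leaves behind on meeting the next letter.\<close>

locale left_domino = normalisation +
  assumes normal_iff: "w \<in> lists S \<Longrightarrow>
      normal_word N w \<longleftrightarrow> (\<forall>x. sublist x w \<and> length x = 2 \<longrightarrow> normal_word N x)"
    and domino: "x \<in> S \<Longrightarrow> s \<in> S \<Longrightarrow> y \<in> S \<Longrightarrow> N [s, y] = [s, y] \<Longrightarrow> N [x, s] = [x', s'] \<Longrightarrow>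
      N [x', hd (N [s', y])] = [x', hd (N [s', y])]"
begin

lemma normal_Cons_Cons:
  assumes "a # b # w \<in> lists S"
  shows "N (a # b # w) = a # b # w \<longleftrightarrow> N [a, b] = [a, b] \<and> N (b # w) = b # w"
proof -
  have "sublist x (a # b # w) \<and> length x = 2 \<longleftrightarrow> x = [a, b] \<or> sublist x (b # w) \<and> length x = 2" for x
    by (cases x rule: list.exhaust[case_product list.exhaust])
      (auto simp: sublist_Cons_right numeral_2_eq_2 length_Suc_conv prefix_Cons)
  moreover have "b # w \<in> lists S" using assms by simp
  ultimately show ?thesis
    using normal_iff[OF assms] normal_iff[of "b # w"] unfolding normal_word_def by metis
qed

text \<open>The letter \<open>x\<close> travels through the normal word from left to right, and by
  the domino rule each letter left behind is compatible with the next one. So \<open>a\<close> is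
  final after the first encounter.\<close>

lemma N_Cons_normal:
  assumes "x \<in> S" "y # ys \<in> lists S" "N (y # ys) = y # ys" "N [x, y] = [a, b]"
  shows "N (x # y # ys) = a # N (b # ys)"
  using assms
proof (induction ys arbitrary: x y a b)
  case Nil
  have "b \<in> S" using closed[of "[x, y]"] Nil by simp
  then show ?case using Nil letter[of "[b]"] by simp
next
  case (Cons z zs)
  have S: "a \<in> S" "b \<in> S" "z \<in> S" "y \<in> S" "zs \<in> lists S"
    using closed[of "[x, y]"] Cons.prems by auto
  have yz: "N [y, z] = [y, z]" and zzs: "N (z # zs) = z # zs"
    using normal_Cons_Cons[of y z zs] Cons.prems by auto
  obtain c d where cd: "N [b, z] = [c, d]" "c \<in> S" "d \<in> S"
    using N_pair S by metis
  have IH: "N (b # z # zs) = c # N (d # zs)"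
    using Cons.IH[of b z c d] S zzs cd by simp
  have "N [a, c] = [a, c]"
    using domino[OF Cons.prems(1) S(4,3) yz Cons.prems(4)] cd by simp
  moreover have "N (c # N (d # zs)) = c # N (d # zs)"
    using idem[of "b # z # zs"] S by (simp add: IH)
  moreover have "N (d # zs) \<in> lists S"
    using closed cd S by simp
  ultimately have "N (a # N (b # z # zs)) = a # N (b # z # zs)"
    using normal_Cons_Cons[of a c "N (d # zs)"] S cd IH by simp
  moreover have "N (a # N (b # z # zs)) = N (a # b # z # zs)"
    using absorb[of "[a]" "[]" "b # z # zs"] S by simp
  moreover have "N (a # b # z # zs) = N (x # y # z # zs)"
    using absorb[of "[]" "z # zs" "[x, y]"] S Cons.prems by simp
  ultimately show ?case by simp
qed

text \<open>If \<open>v\<close> is normalised first, the pass of \<open>x\<close> settles the first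
  letter at once. Hence first letters of normal forms can be computed from right to left, one letter
  at a time.\<close>

lemma hd_N_Cons:
  assumes "x \<in> S" "v \<in> lists S" "v \<noteq> []"
  shows "hd (N (x # v)) = hd (N [x, hd (N v)])"
proof -
  obtain y ys where v: "N v = y # ys"
    using length_preserving[OF assms(2)] assms(3) by (cases "N v") auto
  have S: "y # ys \<in> lists S" using closed[OF assms(2)] v by simp
  then obtain a b where ab: "N [x, y] = [a, b]"
    using N_pair assms(1) by (metis Cons_in_lists_iff)
  have "N (x # v) = N (x # y # ys)"
    using absorb[of "[x]" "[]" v] assms v by simp
  also have "\<dots> = a # N (b # ys)"
    using N_Cons_normal[OF assms(1) S _ ab] idem[OF assms(2)] v by simp
  finally show ?thesis using ab v by simp
qed

text \<open>Computed from right to left, both first letters start from \<open>s'\<close> and then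
  meet the same letters of \<open>u\<close>.\<close>

lemma hd_N_snoc:
  assumes "u \<in> lists S" "s \<in> S" "t \<in> S" "N [s, t] = [s', t']"
  shows "hd (N (u @ [s'])) = hd (N (u @ [s, t]))"
  using assms(1)
proof (induction u)
  case Nil
  then show ?case
    using assms closed[of "[s, t]"] letter[of "[s']"] by simp
next
  case (Cons x u)
  have "s' \<in> S" using assms closed[of "[s, t]"] by simp
  then show ?case
    using Cons assms hd_N_Cons[of x "u @ [s']"] hd_N_Cons[of x "u @ [s, t]"] by simp
qed

section \<open>Following a rewriting sequence\<close>

text \<open>The factor consists of the entries \<open>k\<close> to \<open>j - 1\<close>. It must be
  nonempty for its head to be meaningful, whence the condition \<open>k + 1 < j\<close> in
  \<open>bounds\<close>.\<close>

definition factor_hd :: "'a list \<Rightarrow> nat \<Rightarrow> nat \<Rightarrow> 'a" where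
  "factor_hd w k j = hd (N (take (j - k) (drop k w)))"

text \<open>A certificate rather than a function of the word: \<open>m\<close> records what the
  rewriting history guarantees, and the true range of normality may be larger.\<close>

definition bounds :: "'a list \<Rightarrow> (nat \<Rightarrow> nat) \<Rightarrow> bool" where
  "bounds w m \<longleftrightarrow> (\<forall>k<length w. k < m k \<and>
    (\<forall>j. k + 1 < j \<and> j \<le> m k \<and> j \<le> length w \<longrightarrow>
       N [w ! k, factor_hd w (k + 1) j] = [w ! k, factor_hd w (k + 1) j]))"

lemma bounds_Suc: "bounds w Suc"
  unfolding bounds_def by auto

text \<open>For an entry \<open>k\<close> left of the step, a factor containing both rewritten
  letters keeps its normal form by \<open>absorb\<close>, and one ending between them takes over the
  first letter of the old factor one letter longer. At the step itself, the domino rule turns what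
  was known for \<open>t\<close> into the same range for \<open>s'\<close>.\<close>

lemma bounds_step:
  assumes S: "u \<in> lists S" "v \<in> lists S" "s \<in> S" "t \<in> S" and ne: "N [s, t] \<noteq> [s, t]"
    and bounds: "bounds (u @ [s, t] @ v) m"
  shows "m (length u) = length u + 1"
    and "bounds (u @ N [s, t] @ v) (bound_update (length u) m)"
proof -
  define i where "i = length u"
  obtain s' t' where st: "N [s, t] = [s', t']" "s' \<in> S" "t' \<in> S"
    using N_pair S by metis
  let ?w = "u @ [s, t] @ v" and ?w' = "u @ [s', t'] @ v"
  have pos: "k < m k" if "k < length ?w" for k
    using bounds that unfolding bounds_def by blast
  have normal: "N [?w ! k, factor_hd ?w (k + 1) j] = [?w ! k, factor_hd ?w (k + 1) j]"
    if "k + 1 < j" "j \<le> m k" "j \<le> length ?w" for k j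
    using bounds that unfolding bounds_def by (meson add_lessD1 less_le_trans)
  have len: "length ?w' = length ?w" "i + 1 < length ?w" by (simp_all add: i_def)
  have drops: "drop (i + 1) ?w = t # v" "drop (i + 1) ?w' = t' # v"
    by (simp_all add: i_def)
  \<comment> \<open>Otherwise the bound would cover the one-letter factor \<open>[t]\<close> and
    make \<open>[s, t]\<close> normal.\<close>
  show mi: "m (length u) = length u + 1"
  proof (rule ccontr)
    assume "m (length u) \<noteq> length u + 1"
    then have "i + 2 \<le> m i" using pos[of i] by (simp add: i_def)
    moreover have "factor_hd ?w (i + 1) (i + 2) = t"
      unfolding factor_hd_def drops using letter[of "[t]"] S by simp
    ultimately show False
      using normal[of i "i + 2"] ne by (simp add: i_def)
  qed
  have "bounds ?w' (bound_update i m)"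
    unfolding bounds_def
  proof (intro allI impI conjI)
    fix k assume k: "k < length ?w'"
    then show "k < bound_update i m k"
      using pos[of k] pos[of "i + 1"] len unfolding bound_update_def by (auto simp: i_def)
    fix j assume j: "k + 1 < j \<and> j \<le> bound_update i m k \<and> j \<le> length ?w'"
    consider "k < i" | "k = i" | "k = i + 1" | "k > i + 1" by linarith
    then show "N [?w' ! k, factor_hd ?w' (k + 1) j] = [?w' ! k, factor_hd ?w' (k + 1) j]"
    proof cases
      case 1
      define u' where "u' = drop (k + 1) u"
      have u': "u' \<in> lists S" "length u' = i - (k + 1)"
        using S unfolding u'_def i_def by (auto dest: in_set_dropD)
      have dropk: "drop (k + 1) ?w = u' @ [s, t] @ v" "drop (k + 1) ?w' = u' @ [s', t'] @ v"
        using 1 by (simp_all add: i_def u'_def)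
      have nth: "?w' ! k = ?w ! k" using 1 by (simp add: i_def nth_append)
      have mk: "j \<le> m k" using 1 j unfolding bound_update_def by (auto split: if_splits)
      consider "j \<le> i" | "j = i + 1" | "j \<ge> i + 2" by linarith
      then show ?thesis
      proof cases
        case 1
        then have "factor_hd ?w' (k + 1) j = factor_hd ?w (k + 1) j"
          unfolding factor_hd_def dropk using u' by simp
        then show ?thesis using normal[of k j] mk j nth by simp
      next
        case 2
        \<comment> \<open>A bound equal to \<open>i + 1\<close> would have been lowered to
          \<open>i\<close>, excluding \<open>j\<close>. So the old bound reaches
          \<open>i + 2\<close>, as the longer factor requires.\<close>
        have "m k \<noteq> i + 1" using j 2 \<open>k < i\<close> unfolding bound_update_def by auto
        then have m: "i + 2 \<le> m k" using mk 2 by simp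
        have "j - (k + 1) = length u' + 1" "i + 2 - (k + 1) = length u' + 2"
          using u' 2 \<open>k < i\<close> by auto
        then have "factor_hd ?w' (k + 1) j = factor_hd ?w (k + 1) (i + 2)"
          unfolding factor_hd_def dropk using hd_N_snoc[OF u'(1) S(3,4) st(1)] by simp
        then show ?thesis using normal[of k "i + 2"] m \<open>k < i\<close> len nth by simp
      next
        case 3
        define v' where "v' = take (j - i - 2) v"
        have v': "v' \<in> lists S" using S unfolding v'_def by (auto dest: in_set_takeD)
        have "j - (k + 1) = length u' + 2 + (j - i - 2)" using u' 3 \<open>k < i\<close> by simp
        then have "take (j - (k + 1)) (u' @ [a, b] @ v) = u' @ [a, b] @ v'" for a b
          by (simp add: v'_def)
        then have "factor_hd ?w' (k + 1) j = factor_hd ?w (k + 1) j"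
          unfolding factor_hd_def dropk using absorb[OF u'(1) v', of "[s, t]"] S st by simp
        then show ?thesis using normal[of k j] mk j nth by simp
      qed
    next
      case 2
      have jm: "j \<le> m (i + 1)" using j 2 unfolding bound_update_def by simp
      have nth: "?w' ! k = s'" "?w ! (i + 1) = t" using 2 by (simp_all add: i_def nth_append)
      show ?thesis
      \<comment> \<open>For \<open>j = i + 2\<close> nothing of \<open>v\<close> enters the factor,
        and the claim is that \<open>[s', t']\<close> is normal. Beyond that, \<open>y\<close> is
        the first letter that \<open>t'\<close> meets.\<close>
      proof (cases "j = i + 2")
        case True
        then have "factor_hd ?w' (k + 1) j = t'"
          unfolding factor_hd_def 2 drops using letter[of "[t']"] st by simp
        then show ?thesis using nth st idem[of "[s, t]"] S by simp
      next
        case False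
        then have ji: "i + 2 < j" "j - (i + 1) = Suc (j - (i + 2))" using j 2 by auto
        define v' where "v' = take (j - (i + 2)) v"
        have v': "v' \<in> lists S" "v' \<noteq> []"
          using S j ji unfolding v'_def by (auto dest: in_set_takeD simp: i_def)
        define y where "y = hd (N v')"
        have "N v' \<noteq> []" using length_preserving[OF v'(1)] v' by auto
        then have yS: "y \<in> S" using closed[OF v'(1)] unfolding y_def by (cases "N v'") auto
        have "factor_hd ?w (i + 1 + 1) j = y"
          unfolding factor_hd_def y_def v'_def by (simp add: i_def)
        then have ty: "N [t, y] = [t, y]"
          using normal[of "i + 1" j] ji jm j nth by simp
        have "factor_hd ?w' (k + 1) j = hd (N (t' # v'))"
          unfolding factor_hd_def 2 drops v'_def ji(2) by simp
        also have "\<dots> = hd (N [t', y])"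
          unfolding y_def using hd_N_Cons st v' by simp
        finally show ?thesis
          using domino[OF S(3,4) yS ty st(1)] nth by simp
      qed
    next
      case 3
      \<comment> \<open>The reset value \<open>i + 2\<close> is \<open>k + 1\<close>, so no
        \<open>j\<close> is in range.\<close>
      then show ?thesis using j unfolding bound_update_def by auto
    next
      case 4
      then obtain d where "k = length (u @ [s, t]) + d"
        using le_Suc_ex[of "length (u @ [s, t])" k] by (auto simp: i_def)
      then have "drop (k + 1) ?w' = drop (k + 1) ?w" "?w' ! k = ?w ! k"
        by (simp_all add: nth_append numeral_3_eq_3)
      moreover have "j \<le> m k" using 4 j unfolding bound_update_def by simp
      ultimately show ?thesis
        using normal[of k j] j unfolding factor_hd_def by simp
    qed
  qed
  then show "bounds (u @ N [s, t] @ v) (bound_update (length u) m)"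
    by (simp add: st i_def)
qed

lemma rewrite_step_potential:
  assumes "rewrite_step S (normalisation_rules S N) w w'" "bounds w m"
  obtains m' where "bounds w' m'" "potential (length w) m' < potential (length w) m"
proof -
  obtain u s t v where *: "u \<in> lists S" "v \<in> lists S" "s \<in> S" "t \<in> S" "N [s, t] \<noteq> [s, t]"
    "w = u @ [s, t] @ v" "w' = u @ N [s, t] @ v"
    using assms(1) by (rule rewrite_step_cases)
  note step = bounds_step[OF *(1-5) assms(2)[unfolded *(6)]]
  have "potential (length w) (bound_update (length u) m) < potential (length w) m"
    using step(1) assms(2) * unfolding bounds_def by (intro potential_bound_update) auto
  then show ?thesis using that step(2) * by blast
qed

theorem rewriting_length_bound:
  assumes "\<forall>i<l. rewrite_step S (normalisation_rules S N) (w i) (w (Suc i))"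
  shows "l \<le> 2 ^ length (w 0) - length (w 0) - 1"
proof -
  let ?p = "length (w 0)"
  \<comment> \<open>The certificate depends on the history, so the induction carries it
    existentially.\<close>
  have "\<exists>m. bounds (w n) m \<and> length (w n) = ?p \<and> n + potential ?p m \<le> 2 ^ ?p - 1" if "n \<le> l" for n
    using that
  proof (induction n)
    case 0
    show ?case using bounds_Suc potential_Suc by (intro exI[of _ Suc]) simp
  next
    case (Suc n)
    then obtain m where m: "bounds (w n) m" "length (w n) = ?p" "n + potential ?p m \<le> 2 ^ ?p - 1"
      by auto
    have step: "rewrite_step S (normalisation_rules S N) (w n) (w (Suc n))"
      using assms Suc.prems by simp
    obtain m' where "bounds (w (Suc n)) m'" "potential ?p m' < potential ?p m"
      using rewrite_step_potential[OF step m(1)] m(2) by metis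
    then show ?case
      using m rewrite_step_invariants(3)[OF step] by (intro exI[of _ m']) simp
  qed
  then obtain m where "l + potential ?p m \<le> 2 ^ ?p - 1" by blast
  then show ?thesis using potential_ge[of ?p m] by simp
qed

end

section \<open>The two classes\<close>

context quadratic_normalisation_4_3
begin

text \<open>In the sequence 212 applied to \<open>[x, s, y]\<close> the first move is idle because
  \<open>[s, y]\<close> is normal. The other two give \<open>x'\<close> followed by
  \<open>N [s', y]\<close>, so this word is normal, and with it its first two letters.\<close>

lemma left_domino: "left_domino S N"
proof
  fix x s y x' s'
  assume S: "x \<in> S" "s \<in> S" "y \<in> S" and sy: "N [s, y] = [s, y]" and xs: "N [x, s] = [x', s']"
  have S': "x' \<in> S" "s' \<in> S" using closed[of "[x, s]"] S xs by auto
  obtain a b where ab: "N [s', y] = [a, b]" using N_pair S S' by metis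
  have "N [x, s, y] = norm_seq N [2, 1, 2] [x, s, y]"
    using class_4_3[of "[x, s, y]"] S by fastforce
  also have "\<dots> = [x', a, b]"
    using sy xs ab by (simp add: norm_seq_def norm_at_def numeral_2_eq_2)
  finally have "normal_word N [x', a, b]"
    using idem[of "[x, s, y]"] S unfolding normal_word_def by simp
  moreover have "sublist [x', a] [x', a, b]" "[x', a, b] \<in> lists S"
    using closed[of "[s', y]"] S S' ab by (auto simp: sublist_Cons_right)
  ultimately have "normal_word N [x', a]"
    using normal_iff_factors[of "[x', a, b]"] by (metis length_Cons list.size(3) numeral_2_eq_2)
  then show "N [x', hd (N [s', y])] = [x', hd (N [s', y])]"
    using ab unfolding normal_word_def by simp
qed (use normal_iff_factors in blast)

end

context quadratic_normalisation_3_4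
begin

text \<open>Conjugation by reversal exchanges the positions 1 and 2 in words of length three. The
  sequence 121 on \<open>[y, s, x]\<close> thus plays the part of 212, again with an idle first
  move.\<close>

lemma left_domino_mirror: "left_domino S (\<lambda>w. rev (N (rev w)))"
proof
  show "(\<lambda>w. rev (N (rev w))) \<in> lists S \<rightarrow> lists S"
    using maps_words by (fastforce simp: in_lists_conv_set)
next
  fix w assume w: "w \<in> lists S"
  then have rw: "rev w \<in> lists S" by (simp add: in_lists_conv_set)
  show "length (rev (N (rev w))) = length w"
    using length_preserving[OF rw] by simp
  show "rev (N (rev w)) = w" if "length w = 1"
    using letter[OF rw] that by simp
  have "normal_word (\<lambda>w. rev (N (rev w))) x \<longleftrightarrow> normal_word N (rev x)" for x
    unfolding normal_word_def by (metis rev_rev_ident)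
  then show "normal_word (\<lambda>w. rev (N (rev w))) w \<longleftrightarrow>
      (\<forall>x. sublist x w \<and> length x = 2 \<longrightarrow> normal_word (\<lambda>w. rev (N (rev w))) x)"
    using normal_iff_factors[OF rw] by (metis length_rev rev_rev_ident sublist_rev)
next
  fix u v w assume "u \<in> lists S" "v \<in> lists S" "w \<in> lists S"
  then show "rev (N (rev (u @ rev (N (rev w)) @ v))) = rev (N (rev (u @ w @ v)))"
    using absorb[of "rev v" "rev u" "rev w"] by (simp add: in_lists_conv_set)
next
  fix x s y x' s'
  assume S: "x \<in> S" "s \<in> S" "y \<in> S" and "rev (N (rev [s, y])) = [s, y]"
    and "rev (N (rev [x, s])) = [x', s']"
  then have ys: "N [y, s] = [y, s]" and sx: "N [s, x] = [s', x']" by (simp_all add: rev_swap)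
  have S': "x' \<in> S" "s' \<in> S" using closed[of "[s, x]"] S sx by auto
  obtain a b where ab: "N [y, s'] = [a, b]" using N_pair S S' by metis
  have "N [y, s, x] = norm_seq N [1, 2, 1] [y, s, x]"
    using class_3_4[of "[y, s, x]"] S by fastforce
  also have "\<dots> = [a, b, x']"
    using ys sx ab by (simp add: norm_seq_def norm_at_def numeral_2_eq_2)
  finally have "normal_word N [a, b, x']"
    using idem[of "[y, s, x]"] S unfolding normal_word_def by simp
  moreover have "sublist [b, x'] [a, b, x']" "[a, b, x'] \<in> lists S"
    using closed[of "[y, s']"] S S' ab by (auto simp: sublist_Cons_right)
  ultimately have "normal_word N [b, x']"
    using normal_iff_factors[of "[a, b, x']"] by (metis length_Cons list.size(3) numeral_2_eq_2)
  then show "rev (N (rev [x', hd (rev (N (rev [s', y])))])) = [x', hd (rev (N (rev [s', y])))]"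
    using ab unfolding normal_word_def by simp
qed

end

text \<open>Reversal turns the rule for \<open>[s, t]\<close> into the mirrored rule for
  \<open>[t, s]\<close>; this carries the length bound over to class (3,4).\<close>

lemma rewrite_step_rev:
  assumes "rewrite_step S (normalisation_rules S N) w w'"
  shows "rewrite_step S (normalisation_rules S (\<lambda>w. rev (N (rev w)))) (rev w) (rev w')"
  using assms
proof cases
  case (1 u v l r)
  then obtain s t where "l = [s, t]" "r = N [s, t]" "s \<in> S" "t \<in> S" "rev [t, s] \<noteq> N [s, t]"
    unfolding normalisation_rules_def by auto
  then have "(rev l, rev r) \<in> normalisation_rules S (\<lambda>w. rev (N (rev w)))"
    unfolding normalisation_rules_def mem_Collect_eq
    by - (rule exI[of _ t], rule exI[of _ s], auto simp flip: rev_swap)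
  then show ?thesis
    using rewrite_step.intros[of "rev v" S "rev u" "rev l" "rev r"] 1 by (simp add: in_lists_conv_set)
qed

lemma class_length_bound:
  assumes "quadratic_normalisation_3_4 S N \<or> quadratic_normalisation_4_3 S N"
    and steps: "\<forall>i<l. rewrite_step S (normalisation_rules S N) (w i) (w (Suc i))"
  shows "l \<le> 2 ^ length (w 0) - length (w 0) - 1"
  using assms(1)
proof
  assume "quadratic_normalisation_4_3 S N"
  then interpret left_domino S N by (rule quadratic_normalisation_4_3.left_domino)
  show ?thesis using rewriting_length_bound steps by blast
next
  assume "quadratic_normalisation_3_4 S N"
  then interpret left_domino S "\<lambda>w. rev (N (rev w))"
    by (rule quadratic_normalisation_3_4.left_domino_mirror)
  show ?thesis
    using rewriting_length_bound[of l "\<lambda>i. rev (w i)"] steps rewrite_step_rev by force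
qed

section \<open>Confluence\<close>

context quadratic_normalisation
begin

text \<open>By quadraticity a word that is not normal has a factor of length two that is not normal,
  and this is the left side of a rule.\<close>

lemma irreducible_imp_normal:
  assumes w: "w \<in> lists S" and irr: "\<nexists>w'. rewrite_step S (normalisation_rules S N) w w'"
  shows "N w = w"
proof (rule ccontr)
  assume "N w \<noteq> w"
  then obtain x where x: "sublist x w" "length x = 2" "N x \<noteq> x"
    using normal_iff_factors[OF w] unfolding normal_word_def by blast
  then obtain u v where uv: "w = u @ x @ v" by (auto simp: sublist_def)
  obtain s t where st: "x = [s, t]"
    using x(2) by (auto simp: numeral_2_eq_2 length_Suc_conv)
  have "(x, N x) \<in> normalisation_rules S N"
    using x w uv st unfolding normalisation_rules_def by force
  then show False
    using rewrite_step.intros[of u S v x "N x"] irr w uv by auto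
qed

text \<open>Steps do not change the value of \<open>N\<close>, so the irreducible word eventually
  reached, being normal, is \<open>N w\<close> itself.\<close>

lemma terminating_imp_rewrites_to_N:
  assumes terminating: "terminating S (normalisation_rules S N)" and w: "w \<in> lists S"
  shows "(rewrite_step S (normalisation_rules S N))\<^sup>*\<^sup>* w (N w)"
proof -
  let ?r = "rewrite_step S (normalisation_rules S N)"
  have "wfp ?r\<inverse>\<inverse>"
    using terminating unfolding terminating_def wf_iff_no_infinite_down_chain[to_pred] by simp
  then show ?thesis using w
  proof (induction w rule: wfp_induct_rule)
    case (less w)
    show ?case
    proof (cases "\<exists>w'. ?r w w'")
      case True
      then obtain w' where w': "?r w w'" by blast
      then have "?r\<^sup>*\<^sup>* w' (N w)"
        using less.IH[of w'] rewrite_step_invariants[OF w'] by simp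
      then show ?thesis using w' by (rule converse_rtranclp_into_rtranclp[rotated])
    next
      case False
      then show ?thesis using irreducible_imp_normal less.prems by simp
    qed
  qed
qed

lemma terminating_imp_convergent:
  assumes "terminating S (normalisation_rules S N)"
  shows "convergent_rewriting S (normalisation_rules S N)"
proof -
  let ?r = "rewrite_step S (normalisation_rules S N)"
  have inv: "w' \<in> lists S \<and> N w' = N w" if "?r\<^sup>*\<^sup>* w w'" "w \<in> lists S" for w w'
    using that by (induction rule: rtranclp_induct) (auto simp: rewrite_step_invariants)
  have outside: "w' = w" if "?r\<^sup>*\<^sup>* w w'" "w \<notin> lists S" for w w'
    using that by (metis converse_rtranclpE rewrite_step_invariants(1))
  have "\<exists>w'. ?r\<^sup>*\<^sup>* w1 w' \<and> ?r\<^sup>*\<^sup>* w2 w'" if "?r\<^sup>*\<^sup>* w w1" "?r\<^sup>*\<^sup>* w w2" for w w1 w2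
  proof (cases "w \<in> lists S")
    case True
    then show ?thesis
      \<comment> \<open>The common reduct is \<open>N w\<close>, which equals both
        \<open>N w1\<close> and \<open>N w2\<close>.\<close>
      using inv that terminating_imp_rewrites_to_N[OF assms] by metis
  next
    case False
    then show ?thesis using outside that by blast
  qed
  then have "confluentp ?r" by (rule confluentpI)
  then show ?thesis using assms unfolding convergent_rewriting_def by blast
qed

end

theorem theoremB:
  fixes S :: "'a set" and N :: "'a list \<Rightarrow> 'a list"
  assumes "quadratic_normalisation_3_4 S N \<or> quadratic_normalisation_4_3 S N"
  defines "R \<equiv> normalisation_rules S N"
  shows "convergent_rewriting S R
    \<and> (\<forall>(p::nat) (l::nat) (w :: nat \<Rightarrow> 'a list).
         w 0 \<in> lists S \<and> length (w 0) = p \<and> (\<forall>i<l. rewrite_step S R (w i) (w (Suc i)))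
           \<longrightarrow> l \<le> 2 ^ p - p - 1)"
proof
  interpret quadratic_normalisation S N
    using assms(1) quadratic_normalisation_3_4.axioms(1) quadratic_normalisation_4_3.axioms(1)
    by blast
  have "terminating S R"
    unfolding terminating_def
  proof
    assume "\<exists>f. \<forall>i. rewrite_step S R (f i) (f (Suc i))"
    then obtain f where f: "\<forall>i. rewrite_step S R (f i) (f (Suc i))" by blast
    \<comment> \<open>All initial segments of the infinite sequence share a bound that depends only
      on \<open>f 0\<close>.\<close>
    have "l \<le> 2 ^ length (f 0) - length (f 0) - 1" for l
      using class_length_bound[OF assms(1), of l f] f unfolding R_def by blast
    then show False by (meson not_less_eq_eq)
  qed
  then show "convergent_rewriting S R"
    unfolding R_def by (rule terminating_imp_convergent)
next
  show "\<forall>p l w. w 0 \<in> lists S \<and> length (w 0) = p \<and> (\<forall>i<l. rewrite_step S R (w i) (w (Suc i)))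
      \<longrightarrow> l \<le> 2 ^ p - p - 1"
    using class_length_bound[OF assms(1)] unfolding R_def by blast
qed

end
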